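(* Let $k\ge 2$ be an integer. The map $\underline{\phi_k}:\mathbb{R}^2/G\to A_{2k}$ is bijective. Its restriction to $(\mathbb{R}\times\mathbb{R}^* )/G$ (the classes of points $(p,q)$ with $q\neq 0$) is a diffeomorphism $(\mathbb{R}\times\mathbb{R}^* )/G\simeq A_{2k}\setminus\{0\}$.
   Context: $\mathbb{R}^2$ has coordinates $(p,q)$; $G\simeq\mathbb{Z}$ acts by $n\cdot(p,q)=(p+nq,q)$. $\mathbb{R}^2/G$ denotes the quotient of $\mathbb{R}^2$ by the closed equivalence relation: $(p,q)\sim(p+nq,q)$ for $n\in\mathbb{Z}$, and $(p,0)\sim(p',0)$ for all $p,p'\in\mathbb{R}$. $A_{2k}=\{(x,y,z)\in\mathbb{R}^3: x^2+y^2=z^{2k}\}$. The map $\phi_k:\mathbb{R}^2\to\mathbb{R}^3$, $\phi_k(p,q)=\left(q^k\cos\frac{2\pi p}{q},\,q^k\sin\frac{2\pi p}{q},\,q\right)$ for $q\neq0$, $\phi_k(p,0)=(0,0,0)$, is constant on equivalence classes and takes values in $A_{2k}$; $\underline{\phi_k}$ is the induced map on $\mathbb{R}^2/G$. *)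

theory Defs
  imports "HOL-Analysis.Analysis"
begin

section \<open>Smooth maps and manifolds\<close>

text \<open>The next two notions are meant for open \<^term>\<open>S\<close>; they then depend on the values
  of \<^term>\<open>f\<close> on \<^term>\<open>S\<close> only.\<close>

fun Ck_on :: "nat \<Rightarrow> 'a::real_normed_vector set \<Rightarrow> ('a \<Rightarrow> 'b::real_normed_vector) \<Rightarrow> bool" where
  "Ck_on 0 S f \<longleftrightarrow> continuous_on S f"
| "Ck_on (Suc n) S f \<longleftrightarrow>
     (\<forall>x\<in>S. f differentiable (at x)) \<and> (\<forall>v. Ck_on n S (\<lambda>x. frechet_derivative f (at x) v))"

definition smooth_on :: "'a::real_normed_vector set \<Rightarrow> ('a \<Rightarrow> 'b::real_normed_vector) \<Rightarrow> bool" where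
  "smooth_on S f \<longleftrightarrow> (\<forall>n. Ck_on n S f)"

text \<open>A chart is a pair of its domain and its coordinate map; the type \<^typ>\<open>'e\<close> of the
  coordinates fixes the dimension.\<close>

type_synonym ('a, 'e) chart = "'a set \<times> ('a \<Rightarrow> 'e)"

definition is_chart :: "'a topology \<Rightarrow> ('a, 'e::euclidean_space) chart \<Rightarrow> bool" where
  "is_chart X = (\<lambda>(U, \<phi>). openin X U \<and> open (\<phi> ` U) \<and>
     homeomorphic_map (subtopology X U) (top_of_set (\<phi> ` U)) \<phi>)"

definition smooth_transition ::
    "('a, 'e::euclidean_space) chart \<Rightarrow> ('a, 'e) chart \<Rightarrow> bool" where
  "smooth_transition = (\<lambda>(U, \<phi>) (V, \<psi>). smooth_on (\<phi> ` (U \<inter> V)) (\<psi> \<circ> inv_into U \<phi>))"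

text \<open>Atlases need not be maximal.\<close>

definition smooth_manifold ::
    "'a topology \<Rightarrow> ('a, 'e::euclidean_space) chart set \<Rightarrow> bool" where
  "smooth_manifold X \<A> \<longleftrightarrow>
     Hausdorff_space X \<and> second_countable X \<and>
     (\<forall>c\<in>\<A>. is_chart X c) \<and> (\<Union>c\<in>\<A>. fst c) = topspace X \<and>
     (\<forall>c\<in>\<A>. \<forall>d\<in>\<A>. smooth_transition c d)"

definition smooth_map ::
    "'a topology \<Rightarrow> ('a, 'e::euclidean_space) chart set \<Rightarrow>
     'b topology \<Rightarrow> ('b, 'f::euclidean_space) chart set \<Rightarrow> ('a \<Rightarrow> 'b) \<Rightarrow> bool" where
  "smooth_map X \<A> Y \<B> f \<longleftrightarrow>
     continuous_map X Y f \<and>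
     (\<forall>(U, \<phi>)\<in>\<A>. \<forall>(V, \<psi>)\<in>\<B>. smooth_on (\<phi> ` (U \<inter> f -` V)) (\<psi> \<circ> f \<circ> inv_into U \<phi>))"

definition diffeomorphism ::
    "'a topology \<Rightarrow> ('a, 'e::euclidean_space) chart set \<Rightarrow>
     'b topology \<Rightarrow> ('b, 'f::euclidean_space) chart set \<Rightarrow> ('a \<Rightarrow> 'b) \<Rightarrow> bool" where
  "diffeomorphism X \<A> Y \<B> f \<longleftrightarrow>
     smooth_manifold X \<A> \<and> smooth_manifold Y \<B> \<and>
     bij_betw f (topspace X) (topspace Y) \<and>
     smooth_map X \<A> Y \<B> f \<and> smooth_map Y \<B> X \<A> (inv_into (topspace X) f)"

section \<open>Quotients and submanifolds\<close>

definition quotient_topology :: "'a::topological_space set \<Rightarrow> ('a \<times> 'a) set \<Rightarrow> 'a set topology" where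
  "quotient_topology S r =
     topology (\<lambda>W. W \<subseteq> S // r \<and> openin (top_of_set S) {x \<in> S. r `` {x} \<in> W})"

lemma openin_quotient_topology:
  "openin (quotient_topology S r) W \<longleftrightarrow>
     W \<subseteq> S // r \<and> openin (top_of_set S) {x \<in> S. r `` {x} \<in> W}"
proof -
  have "istopology (\<lambda>W. W \<subseteq> S // r \<and> openin (top_of_set S) {x \<in> S. r `` {x} \<in> W})"
    unfolding istopology_def
  proof (intro conjI allI impI)
    fix V W
    assume a: "V \<subseteq> S // r \<and> openin (top_of_set S) {x \<in> S. r `` {x} \<in> V}"
      and b: "W \<subseteq> S // r \<and> openin (top_of_set S) {x \<in> S. r `` {x} \<in> W}"
    then show "V \<inter> W \<subseteq> S // r" by blast
    have "{x \<in> S. r `` {x} \<in> V \<inter> W} = {x \<in> S. r `` {x} \<in> V} \<inter> {x \<in> S. r `` {x} \<in> W}"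
      by blast
    then show "openin (top_of_set S) {x \<in> S. r `` {x} \<in> V \<inter> W}"
      using a b by (simp add: openin_Int)
  next
    fix K
    assume K: "\<forall>W\<in>K. W \<subseteq> S // r \<and> openin (top_of_set S) {x \<in> S. r `` {x} \<in> W}"
    then show "\<Union>K \<subseteq> S // r" by blast
    have "{x \<in> S. r `` {x} \<in> \<Union>K} = (\<Union>W\<in>K. {x \<in> S. r `` {x} \<in> W})" by blast
    then show "openin (top_of_set S) {x \<in> S. r `` {x} \<in> \<Union>K}"
      using K by (auto intro!: openin_Union)
  qed
  then show ?thesis
    by (simp add: quotient_topology_def)
qed

lemma topspace_quotient_topology [simp]: "topspace (quotient_topology S r) = S // r"
proof
  show "topspace (quotient_topology S r) \<subseteq> S // r"
    by (metis openin_quotient_topology openin_topspace)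
  have "{x \<in> S. r `` {x} \<in> S // r} = S" by (auto simp: quotientI)
  then have "openin (quotient_topology S r) (S // r)"
    by (simp add: openin_quotient_topology)
  then show "S // r \<subseteq> topspace (quotient_topology S r)"
    by (rule openin_subset)
qed

lemma quotient_map_class: "quotient_map (top_of_set S) (quotient_topology S r) (\<lambda>x. r `` {x})"
  by (auto simp: quotient_map_def openin_quotient_topology quotient_def)

text \<open>The charts of a quotient by a properly discontinuous free action are the local
  inverses of the projection, which is then a local diffeomorphism.\<close>

definition quotient_atlas ::
    "'a::euclidean_space set \<Rightarrow> ('a \<times> 'a) set \<Rightarrow> ('a set, 'a) chart set" where
  "quotient_atlas S r =
     {((\<lambda>x. r `` {x}) ` V, inv_into V (\<lambda>x. r `` {x})) | V. open V \<and> V \<subseteq> S \<and> inj_on (\<lambda>x. r `` {x}) V}"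

text \<open>Smoothness on an arbitrary subset of a Euclidean space: local extendability to smooth maps
  on open sets.\<close>

definition smooth_on_subset ::
    "'a::euclidean_space set \<Rightarrow> ('a \<Rightarrow> 'b::euclidean_space) \<Rightarrow> bool" where
  "smooth_on_subset U f \<longleftrightarrow>
     (\<forall>x\<in>U. \<exists>N g. open N \<and> x \<in> N \<and> smooth_on N g \<and> (\<forall>y\<in>U \<inter> N. g y = f y))"

text \<open>The charts of a submanifold \<^term>\<open>M\<close> of a Euclidean space, with its induced
  differential structure: diffeomorphisms from relatively open subsets of
  \<^term>\<open>M\<close> onto open subsets of the coordinate space.\<close>

definition submanifold_atlas ::
    "'a::euclidean_space set \<Rightarrow> ('a, 'e::euclidean_space) chart set" where
  "submanifold_atlas M =
     {(U, \<psi>). openin (top_of_set M) U \<and> inj_on \<psi> U \<and> open (\<psi> ` U) \<and>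
        smooth_on_subset U \<psi> \<and> smooth_on (\<psi> ` U) (inv_into U \<psi>)}"

section \<open>The quotient of the plane and the surfaces\<close>

definition act :: "int \<Rightarrow> real \<times> real \<Rightarrow> real \<times> real" where
  "act n = (\<lambda>(p, q). (p + of_int n * q, q))"

definition closed_rel :: "((real \<times> real) \<times> (real \<times> real)) set" where
  "closed_rel = {(x, act n x) | x n. True} \<union> {((p, 0), (p', 0)) | p p'. True}"

lemma closed_rel_iff:
  "((p, q), (p', q')) \<in> closed_rel \<longleftrightarrow> q' = q \<and> (q = 0 \<or> (\<exists>n::int. p' = p + of_int n * q))"
  by (auto simp: closed_rel_def act_def)

lemma equiv_closed_rel: "equiv UNIV closed_rel"
proof (rule equivI)
  show "refl closed_rel"
    by (auto simp: refl_on_def closed_rel_iff intro: exI[of _ 0])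
  show "sym closed_rel"
  proof (rule symI, clarify)
    fix p q p' q' :: real
    assume r: "((p, q), (p', q')) \<in> closed_rel"
    show "((p', q'), (p, q)) \<in> closed_rel"
    proof (cases "q = 0")
      case False
      with r obtain n :: int where "q' = q" "p' = p + of_int n * q"
        unfolding closed_rel_iff by blast
      then have "q' = q" "p = p' + of_int (- n) * q'" by simp_all
      then show ?thesis unfolding closed_rel_iff by blast
    qed (use r in \<open>simp add: closed_rel_iff\<close>)
  qed
  show "trans closed_rel"
  proof (rule transI, clarify)
    fix p q p' q' p'' q'' :: real
    assume r: "((p, q), (p', q')) \<in> closed_rel" "((p', q'), (p'', q'')) \<in> closed_rel"
    show "((p, q), (p'', q'')) \<in> closed_rel"
    proof (cases "q = 0")
      case False
      with r obtain m n :: int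
        where "q' = q" "q'' = q" "p' = p + of_int m * q" "p'' = p' + of_int n * q"
        unfolding closed_rel_iff by blast
      then have "q'' = q" "p'' = p + of_int (m + n) * q" by (simp_all add: distrib_right)
      then show ?thesis unfolding closed_rel_iff by blast
    qed (use r in \<open>simp add: closed_rel_iff\<close>)
  qed
qed auto

definition R_Rstar :: "(real \<times> real) set" where
  "R_Rstar = {(p, q). q \<noteq> 0}"

text \<open>\<^term>\<open>A_surface (2 * k)\<close> is the surface $A_{2k}$.\<close>

definition A_surface :: "nat \<Rightarrow> (real \<times> real \<times> real) set" where
  "A_surface m = {(x, y, z). x\<^sup>2 + y\<^sup>2 = z ^ m}"

definition phi :: "nat \<Rightarrow> real \<times> real \<Rightarrow> real \<times> real \<times> real" where
  "phi k = (\<lambda>(p, q). if q = 0 then (0, 0, 0)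
     else (q ^ k * cos (2 * pi * p / q), q ^ k * sin (2 * pi * p / q), q))"

lemma phi_respects: "phi k respects closed_rel"
proof (rule congruentI, clarify)
  fix p q p' q' :: real
  assume r: "((p, q), (p', q')) \<in> closed_rel"
  show "phi k (p, q) = phi k (p', q')"
  proof (cases "q = 0")
    case False
    then obtain n :: int where "q' = q" "p' = p + of_int n * q"
      using r by (auto simp: closed_rel_iff)
    moreover have "2 * pi * (p + of_int n * q) / q = 2 * pi * p / q + 2 * pi * of_int n"
      using False by (simp add: field_simps)
    ultimately show ?thesis
      by (simp add: phi_def sin_add cos_add)
  qed (use r in \<open>auto simp: closed_rel_iff phi_def\<close>)
qed

lemma phi_in_A_surface: "k > 0 \<Longrightarrow> phi k x \<in> A_surface (2 * k)"
proof (cases x)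
  case (Pair p q)
  assume "k > 0"
  have "(q ^ k * cos t)\<^sup>2 + (q ^ k * sin t)\<^sup>2 = q ^ (2 * k)" for t
  proof -
    have "(q ^ k * cos t)\<^sup>2 + (q ^ k * sin t)\<^sup>2 = (q ^ k)\<^sup>2 * ((cos t)\<^sup>2 + (sin t)\<^sup>2)"
      unfolding power_mult_distrib distrib_left ..
    then show ?thesis by (simp add: power_mult [symmetric] mult.commute)
  qed
  then show ?thesis
    using Pair \<open>k > 0\<close> by (auto simp: phi_def A_surface_def)
qed

definition phi_bar :: "nat \<Rightarrow> (real \<times> real) set \<Rightarrow> real \<times> real \<times> real" where
  "phi_bar k c = the_elem (phi k ` c)"

lemma phi_bar_class: "phi_bar k (closed_rel `` {x}) = phi k x"
proof -
  have "phi k y = phi k x" if "y \<in> closed_rel `` {x}" for y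
    using that phi_respects[of k] by (auto simp: congruent_def)
  moreover have "x \<in> closed_rel `` {x}"
    using equiv_closed_rel by (rule equiv_class_self) simp
  ultimately have "phi k ` (closed_rel `` {x}) = {phi k x}" by blast
  then show ?thesis by (simp add: phi_bar_def)
qed

end

theory Submission
  imports Defs
begin

text \<open>Two points of the plane have the same image under \<open>phi k\<close> iff they are equivalent, which gives the
  bijection. Away from \<open>q = 0\<close>, the angle \<open>2 * pi * p / q\<close> can be recovered smoothly, by an arctangent
  in suitably rotated coordinates, from a point of the surface near a given one, so \<open>phi k\<close> has
  smooth local inverses defined on open subsets of the ambient space. Hence the local inverses of
  \<open>phi k\<close> are charts of the submanifold, and the charts of the quotient are exactly
  their pullbacks along \<open>phi_bar k\<close>; the smoothness of \<open>phi_bar k\<close>, of its inverse and of the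
  transition maps of the quotient all reduce to that of the transition maps of the submanifold.\<close>

section \<open>Calculus of smooth maps\<close>

lemma Ck_on_subset: "Ck_on n S f \<Longrightarrow> T \<subseteq> S \<Longrightarrow> Ck_on n T f"
  by (induction n arbitrary: f) (auto intro: continuous_on_subset)

text \<open>Since \<open>S\<close> is open, agreement on \<open>S\<close> forces agreement of the
  derivatives at its points, and the induction on the order runs through these. Symmetry reduces the
  equivalence to one implication.\<close>

lemma Ck_on_cong:
  assumes "open S" "\<And>x. x \<in> S \<Longrightarrow> f x = g x"
  shows "Ck_on n S f \<longleftrightarrow> Ck_on n S g"
proof -
  have "Ck_on n S g" if "Ck_on n S f" "\<And>x. x \<in> S \<Longrightarrow> f x = g x" for f g :: "'a \<Rightarrow> 'b"
    using that
  proof (induction n arbitrary: f g)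
    case 0
    then show ?case by (simp cong: continuous_on_cong)
  next
    case (Suc n)
    have deriv: "(g has_derivative frechet_derivative f (at x)) (at x)" if "x \<in> S" for x
    proof (rule has_derivative_transform_within_open[OF _ assms(1) that])
      show "(f has_derivative frechet_derivative f (at x)) (at x)"
        using Suc.prems(1) that by (simp add: frechet_derivative_works[symmetric])
    qed (use Suc.prems(2) in simp)
    have "Ck_on n S (\<lambda>x. frechet_derivative g (at x) v)" for v
    proof (rule Suc.IH[of "\<lambda>x. frechet_derivative f (at x) v"])
      show "Ck_on n S (\<lambda>x. frechet_derivative f (at x) v)"
        using Suc.prems(1) by simp
      show "frechet_derivative f (at x) v = frechet_derivative g (at x) v" if "x \<in> S" for x
        using frechet_derivative_at[OF deriv[OF that]] by simp
    qed
    then show ?case using deriv by (auto simp: differentiable_def)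
  qed
  from this[of f g, OF _ assms(2)] this[of g f, OF _ assms(2)[symmetric]] show ?thesis by blast
qed

text \<open>Allows any known derivative \<open>f'\<close> in place of
  \<open>frechet_derivative\<close>, by uniqueness of derivatives and invariance under agreement on
  open sets.\<close>

lemma Ck_on_SucI:
  assumes "open S" "\<And>x. x \<in> S \<Longrightarrow> (f has_derivative f' x) (at x)"
    and "\<And>v. Ck_on n S (\<lambda>x. f' x v)"
  shows "Ck_on (Suc n) S f"
proof -
  have "Ck_on n S (\<lambda>x. frechet_derivative f (at x) v)" for v
  proof (subst Ck_on_cong[OF assms(1)])
    show "frechet_derivative f (at x) v = f' x v" if "x \<in> S" for x
      using frechet_derivative_at[OF assms(2)[OF that]] by simp
  qed (rule assms(3))
  then show ?thesis using assms(2) by (auto simp: differentiable_def)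
qed

lemma Ck_on_SucD: "Ck_on (Suc n) S f \<Longrightarrow> Ck_on n S f"
proof (induction n arbitrary: f)
  case 0
  then show ?case
    by (auto intro!: differentiable_imp_continuous_on differentiable_at_imp_differentiable_on)
next
  case (Suc n)
  have "Ck_on n S (\<lambda>x. frechet_derivative f (at x) v)" for v
    using Suc.prems by (intro Suc.IH) auto
  then show ?case using Suc.prems by simp
qed

lemma Ck_on_Suc_has_derivative:
  "Ck_on (Suc n) S f \<Longrightarrow> x \<in> S \<Longrightarrow> (f has_derivative frechet_derivative f (at x)) (at x)"
  by (auto simp: frechet_derivative_works[symmetric])

lemma Ck_on_Suc_frechet_derivative:
  "Ck_on (Suc n) S f \<Longrightarrow> Ck_on n S (\<lambda>x. frechet_derivative f (at x) v)"
  by auto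

text \<open>Continuity and differentiability at a point are decided on an open neighbourhood of it;
  the induction applies this to the directional derivatives.\<close>

lemma Ck_on_local:
  assumes "\<And>x. x \<in> S \<Longrightarrow> \<exists>T. open T \<and> x \<in> T \<and> Ck_on n T f"
  shows "Ck_on n S f"
  using assms
proof (induction n arbitrary: f)
  case 0
  then have "isCont f x" if "x \<in> S" for x
    using that continuous_on_eq_continuous_at by fastforce
  then show ?case by (simp add: continuous_at_imp_continuous_on)
next
  case (Suc n)
  have "f differentiable (at x)" if "x \<in> S" for x
    using Suc.prems[OF that] by auto
  moreover have "Ck_on n S (\<lambda>x. frechet_derivative f (at x) v)" for v
    by (rule Suc.IH) (use Suc.prems in fastforce)
  ultimately show ?case by simp
qed

lemma Ck_on_const [intro]: "Ck_on n S (\<lambda>x. c)"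
  by (induction n arbitrary: c) auto

lemma Ck_on_bounded_linear_comp:
  assumes "bounded_linear L" "open S" "Ck_on n S f"
  shows "Ck_on n S (\<lambda>x. L (f x))"
  using assms(3)
proof (induction n arbitrary: f)
  case 0
  then show ?case using assms(1) by (simp add: bounded_linear.continuous_on)
next
  case (Suc n)
  show ?case
    by (rule Ck_on_SucI[OF assms(2)
          bounded_linear.has_derivative[OF assms(1) Ck_on_Suc_has_derivative[OF Suc.prems]]
          Suc.IH[OF Ck_on_Suc_frechet_derivative[OF Suc.prems]]])
qed

lemma Ck_on_ident [intro]: "Ck_on n S (\<lambda>x. x)"
  by (cases n) (auto simp: frechet_derivative_at[OF has_derivative_ident, symmetric])

lemma Ck_on_add:
  assumes "open S" "Ck_on n S f" "Ck_on n S g"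
  shows "Ck_on n S (\<lambda>x. f x + g x)"
  using assms(2,3)
proof (induction n arbitrary: f g)
  case 0
  then show ?case by (auto intro: continuous_intros)
next
  case (Suc n)
  show ?case
    by (rule Ck_on_SucI[OF assms(1) has_derivative_add[OF
            Ck_on_Suc_has_derivative[OF Suc.prems(1)] Ck_on_Suc_has_derivative[OF Suc.prems(2)]]
          Suc.IH[OF Ck_on_Suc_frechet_derivative[OF Suc.prems(1)]
            Ck_on_Suc_frechet_derivative[OF Suc.prems(2)]]])
qed

lemma Ck_on_sum:
  assumes "open S" "\<And>i. i \<in> I \<Longrightarrow> Ck_on n S (f i)"
  shows "Ck_on n S (\<lambda>x. \<Sum>i\<in>I. f i x)"
  using assms(2) by (induction I rule: infinite_finite_induct) (auto intro: Ck_on_add[OF assms(1)])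

lemma Ck_on_bounded_bilinear:
  assumes "bounded_bilinear B" "open S" "Ck_on n S f" "Ck_on n S g"
  shows "Ck_on n S (\<lambda>x. B (f x) (g x))"
  using assms(3,4)
proof (induction n arbitrary: f g)
  case 0
  then show ?case using assms(1) by (simp add: bounded_bilinear.continuous_on)
next
  case (Suc n)
  \<comment> \<open>The product rule keeps \<open>f\<close> and \<open>g\<close> next to their
    derivatives, so all four are needed at order \<open>n\<close>.\<close>
  note S = Ck_on_SucD[OF Suc.prems(1)] Ck_on_SucD[OF Suc.prems(2)]
    Ck_on_Suc_frechet_derivative[OF Suc.prems(1)] Ck_on_Suc_frechet_derivative[OF Suc.prems(2)]
  show ?case
    by (rule Ck_on_SucI[OF assms(2) bounded_bilinear.FDERIV[OF assms(1)
            Ck_on_Suc_has_derivative[OF Suc.prems(1)] Ck_on_Suc_has_derivative[OF Suc.prems(2)]]])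
      (auto intro!: Ck_on_add[OF assms(2)] Suc.IH S)
qed

text \<open>Induction along the chain rule. The intermediate space is Euclidean so that values of
  the inner derivative expand in a finite basis.\<close>

lemma Ck_on_compose:
  fixes f :: "'a::real_normed_vector \<Rightarrow> 'b::euclidean_space" and g :: "'b \<Rightarrow> 'c::real_normed_vector"
  assumes "open S" "Ck_on n S f" "Ck_on n T g" "f ` S \<subseteq> T"
  shows "Ck_on n S (\<lambda>x. g (f x))"
  using assms(2,3)
proof (induction n arbitrary: g)
  case 0
  then show ?case using assms(4) by (auto intro: continuous_on_compose2)
next
  case (Suc n)
  define f' g' where "f' = (\<lambda>x. frechet_derivative f (at x))"
    and "g' = (\<lambda>x. frechet_derivative g (at x))"
  have deriv: "((\<lambda>x. g (f x)) has_derivative (\<lambda>v. g' (f x) (f' x v))) (at x)" if "x \<in> S" for x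
    unfolding f'_def g'_def
    by (rule has_derivative_compose[OF Ck_on_Suc_has_derivative[OF Suc.prems(1) that]
          Ck_on_Suc_has_derivative[OF Suc.prems(2)]]) (use that assms(4) in auto)
  have linear: "linear (g' (f x))" if "x \<in> S" for x
    unfolding g'_def
    by (rule has_derivative_linear[OF Ck_on_Suc_has_derivative[OF Suc.prems(2)]])
      (use that assms(4) in auto)
  \<comment> \<open>Expanding the inner derivative in a basis leaves outer derivatives in constant directions only,
    to which the induction hypothesis applies.\<close>
  have "Ck_on n S (\<lambda>x. \<Sum>b\<in>Basis. (f' x v \<bullet> b) *\<^sub>R g' (f x) b)" for v
  proof (intro Ck_on_sum[OF assms(1)] Ck_on_bounded_bilinear[OF bounded_bilinear_scaleR assms(1)])
    fix b :: 'b
    show "Ck_on n S (\<lambda>x. f' x v \<bullet> b)"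
      unfolding f'_def
      by (rule Ck_on_bounded_linear_comp[OF bounded_linear_inner_left assms(1)
            Ck_on_Suc_frechet_derivative[OF Suc.prems(1)]])
    show "Ck_on n S (\<lambda>x. g' (f x) b)"
      unfolding g'_def
      by (rule Suc.IH[OF Ck_on_SucD[OF Suc.prems(1)] Ck_on_Suc_frechet_derivative[OF Suc.prems(2)]])
  qed
  moreover have "(\<Sum>b\<in>Basis. (f' x v \<bullet> b) *\<^sub>R g' (f x) b) = g' (f x) (f' x v)"
    if "x \<in> S" for x v
  proof -
    have "g' (f x) (\<Sum>b\<in>Basis. (f' x v \<bullet> b) *\<^sub>R b) = (\<Sum>b\<in>Basis. (f' x v \<bullet> b) *\<^sub>R g' (f x) b)"
      unfolding linear_sum[OF linear[OF that]] linear_scale[OF linear[OF that]] ..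
    then show ?thesis by (simp add: euclidean_representation)
  qed
  ultimately have "Ck_on n S (\<lambda>x. g' (f x) (f' x v))" for v
    using Ck_on_cong[OF assms(1), of "\<lambda>x. \<Sum>b\<in>Basis. (f' x v \<bullet> b) *\<^sub>R g' (f x) b"
        "\<lambda>x. g' (f x) (f' x v)" n] by simp
  from Ck_on_SucI[OF assms(1) deriv this] show ?case .
qed

section \<open>Smooth maps and their closure properties\<close>

lemma smooth_on_subset_dom: "smooth_on S f \<Longrightarrow> T \<subseteq> S \<Longrightarrow> smooth_on T f"
  by (auto simp: smooth_on_def intro: Ck_on_subset)

lemma smooth_on_cong:
  "open S \<Longrightarrow> (\<And>x. x \<in> S \<Longrightarrow> f x = g x) \<Longrightarrow> smooth_on S f \<longleftrightarrow> smooth_on S g"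
  unfolding smooth_on_def by (metis Ck_on_cong)

lemma smooth_on_local:
  assumes "\<And>x. x \<in> S \<Longrightarrow> \<exists>T. open T \<and> x \<in> T \<and> smooth_on T f"
  shows "smooth_on S f"
  unfolding smooth_on_def
proof
  show "Ck_on n S f" for n
    by (rule Ck_on_local) (use assms in \<open>auto simp: smooth_on_def\<close>)
qed

lemma smooth_on_imp_continuous_on: "smooth_on S f \<Longrightarrow> continuous_on S f"
  unfolding smooth_on_def by (metis Ck_on.simps(1))

lemma smooth_on_const: "smooth_on S (\<lambda>x. c)"
  by (auto simp: smooth_on_def)

lemma smooth_on_compose:
  fixes f :: "'a::real_normed_vector \<Rightarrow> 'b::euclidean_space" and g :: "'b \<Rightarrow> 'c::real_normed_vector"
  shows "open S \<Longrightarrow> smooth_on S f \<Longrightarrow> smooth_on T g \<Longrightarrow> f ` S \<subseteq> T \<Longrightarrow> smooth_on S (\<lambda>x. g (f x))"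
  using Ck_on_compose[of S _ f T g] by (simp add: smooth_on_def)

lemma smooth_on_bounded_linear: "bounded_linear L \<Longrightarrow> open S \<Longrightarrow> smooth_on S L"
  unfolding smooth_on_def using Ck_on_bounded_linear_comp[OF _ _ Ck_on_ident] by blast

lemma smooth_on_add:
  "open S \<Longrightarrow> smooth_on S f \<Longrightarrow> smooth_on S g \<Longrightarrow> smooth_on S (\<lambda>x. f x + g x)"
  by (simp add: smooth_on_def Ck_on_add)

lemma smooth_on_mult:
  fixes f g :: "'a::real_normed_vector \<Rightarrow> real"
  shows "open S \<Longrightarrow> smooth_on S f \<Longrightarrow> smooth_on S g \<Longrightarrow> smooth_on S (\<lambda>x. f x * g x)"
  by (simp add: smooth_on_def Ck_on_bounded_bilinear[OF bounded_bilinear_mult])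

lemma smooth_on_diff:
  fixes f g :: "'a::real_normed_vector \<Rightarrow> real"
  assumes "open S" "smooth_on S f" "smooth_on S g"
  shows "smooth_on S (\<lambda>x. f x - g x)"
  using smooth_on_add[OF assms(1,2) smooth_on_mult[OF assms(1) smooth_on_const[of S "-1"] assms(3)]]
  by simp

lemma smooth_on_power:
  fixes f :: "'a::real_normed_vector \<Rightarrow> real"
  assumes "open S" "smooth_on S f"
  shows "smooth_on S (\<lambda>x. f x ^ n)"
  by (induction n) (auto intro: smooth_on_const smooth_on_mult assms)

text \<open>A pair is the sum of the images of its components under the linear embeddings of the two
  factors.\<close>

lemma smooth_on_Pair:
  assumes "open S" "smooth_on S f" "smooth_on S g"
  shows "smooth_on S (\<lambda>x. (f x, g x))"
proof -
  have linear: "bounded_linear (\<lambda>x. (x, 0))" "bounded_linear (\<lambda>x. (0, x))"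
    by (auto intro!: bounded_linear_Pair bounded_linear_ident bounded_linear_zero)
  have "Ck_on n S (\<lambda>x. (f x, 0) + (0, g x))" for n
    by (rule Ck_on_add[OF assms(1) Ck_on_bounded_linear_comp[OF linear(1) assms(1)]
          Ck_on_bounded_linear_comp[OF linear(2) assms(1)]])
      (use assms in \<open>auto simp: smooth_on_def\<close>)
  then show ?thesis by (simp add: smooth_on_def)
qed

section \<open>Smoothness of elementary real functions\<close>

lemma Ck_on_real_SucI:
  fixes f :: "real \<Rightarrow> real"
  assumes "open S" "\<And>x. x \<in> S \<Longrightarrow> (f has_real_derivative f' x) (at x)" "Ck_on n S f'"
  shows "Ck_on (Suc n) S f"
proof (rule Ck_on_SucI[OF assms(1)])
  show "(f has_derivative (\<lambda>v. f' x * v)) (at x)" if "x \<in> S" for x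
    using assms(2)[OF that] by (simp add: has_field_derivative_def)
  show "Ck_on n S (\<lambda>x. f' x * v)" for v
    by (intro Ck_on_bounded_bilinear[OF bounded_bilinear_mult assms(1,3)]) auto
qed

text \<open>The derivative \<open>- (inverse x * inverse x)\<close> is again built from the function
  itself, so each order of differentiability yields the next.\<close>

lemma smooth_on_inverse_real: "smooth_on (- {0}) (inverse :: real \<Rightarrow> real)"
proof -
  have "Ck_on n (- {0}) (inverse :: real \<Rightarrow> real)" for n
  proof (induction n)
    case 0
    then show ?case by (auto intro!: continuous_intros)
  next
    case (Suc n)
    have "Ck_on n (- {0}) (\<lambda>x::real. - 1 * (inverse x * inverse x))"
      by (intro Ck_on_bounded_bilinear[OF bounded_bilinear_mult] Ck_on_const Suc) auto
    then show ?case
      by (rule Ck_on_real_SucI[rotated -1]) (auto intro!: derivative_eq_intros simp: open_Compl)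
  qed
  then show ?thesis by (simp add: smooth_on_def)
qed

text \<open>The two functions climb the orders together, each being up to sign the derivative of the
  other.\<close>

lemma smooth_on_sin_cos_real: "smooth_on UNIV (sin :: real \<Rightarrow> real)" "smooth_on UNIV (cos :: real \<Rightarrow> real)"
proof -
  have "Ck_on n UNIV (sin :: real \<Rightarrow> real) \<and> Ck_on n UNIV (cos :: real \<Rightarrow> real)" for n
  proof (induction n)
    case 0
    then show ?case by (auto intro!: continuous_intros)
  next
    case (Suc n)
    then have "Ck_on n UNIV (\<lambda>x::real. - 1 * sin x)"
      by (intro Ck_on_bounded_bilinear[OF bounded_bilinear_mult] Ck_on_const) auto
    then have "Ck_on (Suc n) UNIV (cos :: real \<Rightarrow> real)"
      by (rule Ck_on_real_SucI[rotated -1]) (auto intro!: derivative_eq_intros)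
    moreover have "Ck_on (Suc n) UNIV (sin :: real \<Rightarrow> real)"
      by (rule Ck_on_real_SucI[rotated -1, OF conjunct2[OF Suc]]) (auto intro!: derivative_eq_intros)
    ultimately show ?case by blast
  qed
  then show "smooth_on UNIV (sin :: real \<Rightarrow> real)" "smooth_on UNIV (cos :: real \<Rightarrow> real)"
    by (simp_all add: smooth_on_def)
qed

lemma smooth_on_inverse:
  fixes f :: "'a::real_normed_vector \<Rightarrow> real"
  shows "open S \<Longrightarrow> smooth_on S f \<Longrightarrow> (\<And>x. x \<in> S \<Longrightarrow> f x \<noteq> 0) \<Longrightarrow> smooth_on S (\<lambda>x. inverse (f x))"
  by (rule smooth_on_compose[OF _ _ smooth_on_inverse_real]) auto

lemma smooth_on_sin:
  fixes f :: "'a::real_normed_vector \<Rightarrow> real"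
  shows "open S \<Longrightarrow> smooth_on S f \<Longrightarrow> smooth_on S (\<lambda>x. sin (f x))"
  by (rule smooth_on_compose[OF _ _ smooth_on_sin_cos_real(1)]) auto

lemma smooth_on_cos:
  fixes f :: "'a::real_normed_vector \<Rightarrow> real"
  shows "open S \<Longrightarrow> smooth_on S f \<Longrightarrow> smooth_on S (\<lambda>x. cos (f x))"
  by (rule smooth_on_compose[OF _ _ smooth_on_sin_cos_real(2)]) auto

text \<open>The derivative \<open>inverse (1 + x\<^sup>2)\<close> is already smooth, which gives
  every order \<open>Suc n\<close> at once, and order 0 by lowering.\<close>

lemma smooth_on_arctan:
  fixes f :: "'a::real_normed_vector \<Rightarrow> real"
  assumes "open S" "smooth_on S f"
  shows "smooth_on S (\<lambda>x. arctan (f x))"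
proof -
  have "1 + x\<^sup>2 \<noteq> 0" for x :: real
    by (metis add_pos_nonneg less_irrefl zero_le_power2 zero_less_one)
  then have "smooth_on UNIV (\<lambda>x::real. inverse (1 + x\<^sup>2))"
    by (intro smooth_on_inverse smooth_on_add smooth_on_power smooth_on_const
        smooth_on_bounded_linear bounded_linear_ident) auto
  then have "Ck_on (Suc n) UNIV (arctan :: real \<Rightarrow> real)" for n
    by (intro Ck_on_real_SucI[where f' = "\<lambda>x. inverse (1 + x\<^sup>2)"]) (auto simp: smooth_on_def DERIV_arctan)
  then have "smooth_on UNIV (arctan :: real \<Rightarrow> real)"
    using Ck_on_SucD unfolding smooth_on_def by blast
  then show ?thesis by (rule smooth_on_compose[OF assms]) auto
qed

text \<open>Near each point \<open>g\<close> may be replaced by a smooth extension \<open>h\<close>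
  on an open set \<open>N\<close>, and the composite is then smooth on the open preimage of
  \<open>N\<close>.\<close>

lemma smooth_on_subset_compose:
  fixes f :: "'a::euclidean_space \<Rightarrow> 'b::euclidean_space" and g :: "'b \<Rightarrow> 'c::euclidean_space"
  assumes "open S" "smooth_on S f" "smooth_on_subset U g" "f ` S \<subseteq> U"
  shows "smooth_on S (g \<circ> f)"
proof (rule smooth_on_local)
  fix x assume x: "x \<in> S"
  with assms(4) have "f x \<in> U" by blast
  with assms(3) obtain N h where N: "open N" "f x \<in> N" "smooth_on N h" "\<forall>y\<in>U \<inter> N. h y = g y"
    unfolding smooth_on_subset_def by blast
  define T where "T = S \<inter> f -` N"
  have T: "open T" unfolding T_def
    using assms(1) N(1) smooth_on_imp_continuous_on[OF assms(2)] by (simp add: continuous_open_preimage)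
  have "smooth_on T (\<lambda>x. h (f x))"
    by (rule smooth_on_compose[OF T smooth_on_subset_dom[OF assms(2)] N(3)]) (auto simp: T_def)
  moreover have "h (f y) = (g \<circ> f) y" if "y \<in> T" for y
    using that N(4) assms(4) by (auto simp: T_def)
  ultimately have "smooth_on T (g \<circ> f)"
    using smooth_on_cong[OF T, of "\<lambda>x. h (f x)" "g \<circ> f"] by simp
  then show "\<exists>T. open T \<and> x \<in> T \<and> smooth_on T (g \<circ> f)"
    using T x N(2) by (auto simp: T_def)
qed

lemma smooth_on_subset_imp_continuous_on:
  assumes "smooth_on_subset U f"
  shows "continuous_on U f"
  unfolding continuous_on_eq_continuous_within
proof
  fix x assume x: "x \<in> U"
  with assms obtain N h where N: "open N" "x \<in> N" "smooth_on N h" "\<forall>y\<in>U \<inter> N. h y = f y"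
    unfolding smooth_on_subset_def by blast
  then have "isCont h x"
    using smooth_on_imp_continuous_on[OF N(3)] by (simp add: continuous_on_eq_continuous_at)
  then have "continuous (at x within U) h"
    by (rule continuous_at_imp_continuous_at_within)
  \<comment> \<open>\<open>h\<close> and \<open>f\<close> agree on \<open>U \<inter> N\<close>,
    which is relatively open in \<open>U\<close>.\<close>
  then show "continuous (at x within U) f"
    using N x by (intro continuous_transform_within_openin[of x U h "U \<inter> N" f])
      (simp_all add: openin_open_Int)
qed

section \<open>Charts of submanifolds and pullbacks of atlases\<close>

lemma is_chart_inj_on: "is_chart X (U, \<phi>) \<Longrightarrow> inj_on \<phi> U"
  using homeomorphic_imp_injective_map[of "subtopology X U" _ \<phi>]
  by (auto simp: is_chart_def Int_absorb1 dest: openin_subset)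

text \<open>A chart is an open map onto an open set. This makes overlaps open in coordinates, where
  smoothness may be transferred between maps that agree.\<close>

lemma is_chart_open_image:
  assumes "is_chart X (U, \<phi>)" "openin X W" "W \<subseteq> U"
  shows "open (\<phi> ` W)"
proof -
  have "openin (subtopology X U) W"
    using assms(2,3) by (auto simp: openin_subtopology)
  moreover have "open_map (subtopology X U) (top_of_set (\<phi> ` U)) \<phi>" and "open (\<phi> ` U)"
    using assms(1) by (auto simp: is_chart_def intro: homeomorphic_imp_open_map)
  ultimately show ?thesis
    by (auto simp: open_map_def openin_open_eq)
qed

lemma submanifold_atlas_is_chart:
  fixes M :: "'a::euclidean_space set" and \<phi> :: "'a \<Rightarrow> 'e::euclidean_space"
  assumes "(U, \<phi>) \<in> submanifold_atlas M"
  shows "is_chart (top_of_set M) (U, \<phi>)"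
proof -
  have U: "openin (top_of_set M) U" "inj_on \<phi> U" "open (\<phi> ` U)" "smooth_on_subset U \<phi>"
    "smooth_on (\<phi> ` U) (inv_into U \<phi>)"
    using assms by (auto simp: submanifold_atlas_def)
  have "subtopology (top_of_set M) U = top_of_set U"
    using openin_subset[OF U(1)] by (simp add: subtopology_subtopology Int_absorb1)
  moreover have "homeomorphic_maps (top_of_set U) (top_of_set (\<phi> ` U)) \<phi> (inv_into U \<phi>)"
    using smooth_on_subset_imp_continuous_on[OF U(4)] smooth_on_imp_continuous_on[OF U(5)] U(2)
    by (auto simp: homeomorphic_maps_def inv_into_into f_inv_into_f)
  ultimately show ?thesis
    using U by (auto simp: is_chart_def homeomorphic_map_maps)
qed

text \<open>The transition map is the smooth inverse of one chart followed by a locally extendable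
  map.\<close>

lemma submanifold_atlas_smooth_transition:
  fixes M :: "'a::euclidean_space set" and \<phi> \<psi> :: "'a \<Rightarrow> 'e::euclidean_space"
  assumes "(U, \<phi>) \<in> submanifold_atlas M" "(V, \<psi>) \<in> submanifold_atlas M"
  shows "smooth_transition (U, \<phi>) (V, \<psi>)"
proof -
  have U: "inj_on \<phi> U" "smooth_on (\<phi> ` U) (inv_into U \<phi>)" "openin (top_of_set M) (U \<inter> V)"
    and V: "smooth_on_subset V \<psi>"
    using assms by (auto simp: submanifold_atlas_def)
  have "open (\<phi> ` (U \<inter> V))"
    by (rule is_chart_open_image[OF submanifold_atlas_is_chart[OF assms(1)] U(3)]) auto
  moreover have "smooth_on (\<phi> ` (U \<inter> V)) (inv_into U \<phi>)"
    by (rule smooth_on_subset_dom[OF U(2)]) auto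
  moreover have "inv_into U \<phi> ` \<phi> ` (U \<inter> V) \<subseteq> V"
    using U(1) by auto
  ultimately show ?thesis
    using smooth_on_subset_compose[OF _ _ V] by (simp add: smooth_transition_def)
qed

text \<open>Separation and countability are inherited from the ambient space, and the charts are
  compatible by construction; only the covering of \<open>M\<close> has to be supplied.\<close>

lemma smooth_manifold_submanifold_atlas:
  fixes M :: "'a::euclidean_space set"
  assumes "(\<Union>c\<in>(submanifold_atlas M :: ('a, 'e::euclidean_space) chart set). fst c) = M"
  shows "smooth_manifold (top_of_set M) (submanifold_atlas M :: ('a, 'e) chart set)"
proof -
  have "second_countable (euclidean :: 'a topology)"
  proof -
    obtain B :: "'a set set" where "countable B" "\<And>C. C \<in> B \<Longrightarrow> open C"
      and union: "\<And>S. open S \<Longrightarrow> \<exists>U. U \<subseteq> B \<and> S = \<Union>U"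
      using univ_second_countable by blast
    moreover have "\<exists>V\<in>B. x \<in> V \<and> V \<subseteq> U" if "open U" "x \<in> U" for U x
      using union[OF that(1)] that(2) by blast
    ultimately show ?thesis
      unfolding second_countable_def by auto
  qed
  then have "second_countable (top_of_set M)"
    by (rule second_countable_subtopology)
  moreover have "Hausdorff_space (top_of_set M)"
    by (simp add: Hausdorff_space_subtopology)
  moreover have "is_chart (top_of_set M) c" "smooth_transition c d"
    if "c \<in> submanifold_atlas M" "d \<in> submanifold_atlas M" for c d :: "('a, 'e) chart"
    using that submanifold_atlas_is_chart[of "fst c" "snd c" M]
      submanifold_atlas_smooth_transition[of "fst c" "snd c" M "fst d" "snd d"] by simp_all
  ultimately show ?thesis
    unfolding smooth_manifold_def using assms by auto
qed

text \<open>If the charts of \<open>\<A>\<close> are charts of \<open>\<B>\<close> read through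
  \<open>F\<close>, then the transition maps of \<open>\<A>\<close> and the coordinate expressions
  of \<open>F\<close> and of its inverse are all transition maps of \<open>\<B>\<close>. In
  particular the manifold structure on \<open>X\<close> is a conclusion.\<close>

lemma diffeomorphism_pullback:
  fixes \<A> :: "('a, 'e::euclidean_space) chart set" and \<B> :: "('b, 'e) chart set"
  assumes F: "homeomorphic_map X Y F" and Y: "smooth_manifold Y \<B>"
    and cover: "(\<Union>c\<in>\<A>. fst c) = topspace X"
    and pullback: "\<And>U \<phi>. (U, \<phi>) \<in> \<A> \<Longrightarrow> \<exists>\<xi>. (F ` U, \<xi>) \<in> \<B> \<and> (\<forall>x\<in>U. \<phi> x = \<xi> (F x))"
  shows "diffeomorphism X \<A> Y \<B> F"
proof -
  define G where "G = inv_into (topspace X) F"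
  have inj: "inj_on F (topspace X)" and image: "F ` topspace X = topspace Y"
    using F by (auto simp: homeomorphic_eq_everything_map)
  have G: "F (G y) = y" "G y \<in> topspace X" if "y \<in> topspace Y" for y
    using that image unfolding G_def by (auto simp: f_inv_into_f inv_into_into)
  have GF: "G (F x) = x" if "x \<in> topspace X" for x
    using that inj by (simp add: G_def)
  have U_sub: "U \<subseteq> topspace X" if "(U, \<phi>) \<in> \<A>" for U \<phi>
    using cover that by force
  have chart_B: "is_chart Y (V, \<psi>)" if "(V, \<psi>) \<in> \<B>" for V \<psi>
    using Y that by (auto simp: smooth_manifold_def)
  have V_sub: "V \<subseteq> topspace Y" if "(V, \<psi>) \<in> \<B>" for V \<psi>
    using chart_B[OF that] by (auto simp: is_chart_def dest: openin_subset)
  have trans_B: "smooth_on (\<phi> ` (U \<inter> V)) (\<psi> \<circ> inv_into U \<phi>)"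
    if "(U, \<phi>) \<in> \<B>" "(V, \<psi>) \<in> \<B>" for U V \<phi> \<psi>
    using Y that by (auto simp: smooth_manifold_def smooth_transition_def)
  have open_B: "open (\<phi> ` (U \<inter> V))" if "(U, \<phi>) \<in> \<B>" "(V, \<psi>) \<in> \<B>" for U V \<phi> \<psi>
    using chart_B[OF that(1)] chart_B[OF that(2)]
    by (intro is_chart_open_image[OF chart_B[OF that(1)]]) (auto simp: is_chart_def)

  \<comment> \<open>On \<open>U\<close> the map \<open>\<phi>\<close> is the restricted
    homeomorphism \<open>F\<close> followed by the chart \<open>\<xi>\<close>.\<close>
  have chart_A: "is_chart X (U, \<phi>)" if c: "(U, \<phi>) \<in> \<A>" for U \<phi>
  proof -
    obtain \<xi> where \<xi>: "(F ` U, \<xi>) \<in> \<B>" "\<forall>x\<in>U. \<phi> x = \<xi> (F x)"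
      using pullback[OF c] by blast
    have image_eq: "\<phi> ` U = \<xi> ` F ` U" using \<xi>(2) by force
    have B: "openin Y (F ` U)" "open (\<xi> ` F ` U)"
      "homeomorphic_map (subtopology Y (F ` U)) (top_of_set (\<xi> ` F ` U)) \<xi>"
      using chart_B[OF \<xi>(1)] by (auto simp: is_chart_def)
    have "homeomorphic_map (subtopology X U) (subtopology Y (F ` U)) F"
      using U_sub[OF c] image V_sub[OF \<xi>(1)]
      by (intro homeomorphic_map_subtopologies[OF F]) (simp add: Int_absorb1)
    from homeomorphic_map_compose[OF this B(3)]
    have "homeomorphic_map (subtopology X U) (top_of_set (\<phi> ` U)) \<phi>"
      unfolding image_eq by (rule homeomorphic_map_eq) (use \<xi>(2) in auto)
    moreover have "openin X U"
      using homeomorphic_map_openness[OF F U_sub[OF c]] B(1) by simp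
    ultimately show ?thesis
      using B(2) by (simp add: is_chart_def image_eq)
  qed

  \<comment> \<open>Stated with a general \<open>h\<close> to serve twice: with \<open>h\<close> a
    chart of \<open>\<A>\<close> for the transition maps, and with \<open>h\<close> equal to
    \<open>\<psi> \<circ> F\<close> for the smoothness of \<open>F\<close>.\<close>
  have transition: "smooth_on (\<phi> ` W) (h \<circ> inv_into U \<phi>)"
    if c: "(U, \<phi>) \<in> \<A>" and d: "(V, \<psi>) \<in> \<B>" and W: "W \<subseteq> U" "F ` W = F ` U \<inter> V"
      and h: "\<And>x. x \<in> W \<Longrightarrow> h x = \<psi> (F x)" for U V W \<phi> \<psi> and h :: "'a \<Rightarrow> 'e"
  proof -
    obtain \<xi> where \<xi>: "(F ` U, \<xi>) \<in> \<B>" "\<forall>x\<in>U. \<phi> x = \<xi> (F x)"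
      using pullback[OF c] by blast
    have image_eq: "\<phi> ` W = \<xi> ` (F ` U \<inter> V)"
      using \<xi>(2) W(1) by (force simp: W(2)[symmetric])
    have "(\<psi> \<circ> inv_into (F ` U) \<xi>) z = (h \<circ> inv_into U \<phi>) z" if z: "z \<in> \<phi> ` W" for z
    proof -
      obtain x where x: "x \<in> W" "z = \<phi> x" using z by blast
      then have "x \<in> U" "z = \<xi> (F x)" using W(1) \<xi>(2) by auto
      then have "inv_into U \<phi> z = x" "inv_into (F ` U) \<xi> z = F x"
        using inv_into_f_f[OF is_chart_inj_on[OF chart_A[OF c]], of x] x(2)
          inv_into_f_f[OF is_chart_inj_on[OF chart_B[OF \<xi>(1)]], of "F x"] by simp_all
      then show ?thesis using h[OF x(1)] by simp
    qed
    then show ?thesis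
      using trans_B[OF \<xi>(1) d] smooth_on_cong[OF open_B[OF \<xi>(1) d], of _ "h \<circ> inv_into U \<phi>"]
      unfolding image_eq by blast
  qed

  have trans_A: "smooth_transition (U, \<phi>) (V, \<psi>)"
    if c: "(U, \<phi>) \<in> \<A>" and d: "(V, \<psi>) \<in> \<A>" for U V \<phi> \<psi>
  proof -
    obtain \<eta> where \<eta>: "(F ` V, \<eta>) \<in> \<B>" "\<forall>x\<in>V. \<psi> x = \<eta> (F x)"
      using pullback[OF d] by blast
    have "F ` (U \<inter> V) = F ` U \<inter> F ` V"
      using inj_on_image_Int[OF inj U_sub[OF c] U_sub[OF d]] .
    then show ?thesis
      using transition[OF c \<eta>(1), of "U \<inter> V" \<psi>] \<eta>(2) by (simp add: smooth_transition_def)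
  qed

  have "smooth_manifold X \<A>"
    using Y cover chart_A trans_A homeomorphic_map_imp_homeomorphic_space[OF F]
    by (auto simp: smooth_manifold_def homeomorphic_Hausdorff_space homeomorphic_space_second_countability)
  moreover have "smooth_map X \<A> Y \<B> F"
  proof -
    have "smooth_on (\<phi> ` (U \<inter> F -` V)) (\<psi> \<circ> F \<circ> inv_into U \<phi>)"
      if c: "(U, \<phi>) \<in> \<A>" and d: "(V, \<psi>) \<in> \<B>" for U V \<phi> \<psi>
      by (rule transition[OF c d]) auto
    then show ?thesis
      using F by (auto simp: smooth_map_def homeomorphic_imp_continuous_map)
  qed
  moreover have "smooth_map Y \<B> X \<A> G"
  proof -
    have "smooth_on (\<psi> ` (V \<inter> G -` U)) (\<phi> \<circ> G \<circ> inv_into V \<psi>)"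
      if c: "(U, \<phi>) \<in> \<A>" and d: "(V, \<psi>) \<in> \<B>" for U V \<phi> \<psi>
    proof -
      obtain \<xi> where \<xi>: "(F ` U, \<xi>) \<in> \<B>" "\<forall>x\<in>U. \<phi> x = \<xi> (F x)"
        using pullback[OF c] by blast
      have dom: "V \<inter> G -` U = V \<inter> F ` U"
        \<comment> \<open>\<open>G\<close> inverts \<open>F\<close> only on the carrier of
          \<open>Y\<close>, which contains \<open>V\<close>.\<close>
        using V_sub[OF d] U_sub[OF c] G(1) GF by (force simp: subset_iff)
      have "(\<xi> \<circ> inv_into V \<psi>) z = (\<phi> \<circ> G \<circ> inv_into V \<psi>) z" if z: "z \<in> \<psi> ` (V \<inter> F ` U)" for z
      proof -
        obtain x where x: "x \<in> U" "F x \<in> V" "z = \<psi> (F x)" using z by blast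
        then show ?thesis
          using is_chart_inj_on[OF chart_B[OF d]] \<xi>(2) GF U_sub[OF c] by auto
      qed
      then show ?thesis
        using trans_B[OF d \<xi>(1)] smooth_on_cong[OF open_B[OF d \<xi>(1)], of _ "\<phi> \<circ> G \<circ> inv_into V \<psi>"]
        unfolding dom by blast
    qed
    moreover have "continuous_map Y X G"
    proof -
      \<comment> \<open>Some continuous inverse \<open>g\<close> exists; on the carrier of
        \<open>Y\<close> it must coincide with \<open>G\<close>.\<close>
      obtain g where g: "homeomorphic_maps X Y F g"
        using F homeomorphic_map_maps by blast
      have "g y = G y" if "y \<in> topspace Y" for y
      proof -
        have "y \<in> F ` topspace X" using that image by simp
        then obtain x where "x \<in> topspace X" "y = F x" by blast
        moreover have "g (F x) = x" if "x \<in> topspace X" for x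
          using that g by (simp add: homeomorphic_maps_def)
        ultimately show ?thesis using GF by simp
      qed
      then show ?thesis
        using g continuous_map_eq[of Y X g G] by (auto simp: homeomorphic_maps_def)
    qed
    ultimately show ?thesis
      by (auto simp: smooth_map_def)
  qed
  ultimately show ?thesis
    using Y inj image by (simp add: diffeomorphism_def bij_betw_def G_def)
qed

section \<open>Quotients by the fibres of a local parametrization\<close>

text \<open>The local inverses are defined on open subsets of the ambient space, so that \<open>M\<close> is
  covered by charts which extend to smooth maps.\<close>

definition smooth_local_parametrization ::
    "'a::euclidean_space set \<Rightarrow> ('a \<Rightarrow> 'b::euclidean_space) \<Rightarrow> 'b set \<Rightarrow> bool" where
  "smooth_local_parametrization S f M \<longleftrightarrow>
     open S \<and> smooth_on S f \<and> f ` S = M \<and>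
     (\<forall>x\<in>S. \<exists>T N g. open T \<and> x \<in> T \<and> T \<subseteq> S \<and> open N \<and> smooth_on N g \<and> f ` T \<subseteq> N \<and>
        (\<forall>y\<in>T. g (f y) = y) \<and> (\<forall>m\<in>M \<inter> N. g m \<in> T \<and> f (g m) = m))"

text \<open>Shrinking \<open>N\<close> to the part that the continuous map \<open>g\<close> sends
  into \<open>V\<close> makes the local inverse land in a prescribed neighbourhood.\<close>

lemma smooth_local_parametrizationE:
  assumes "smooth_local_parametrization S f M" "x \<in> S" "open V" "x \<in> V"
  obtains N g where "open N" "f x \<in> N" "smooth_on N g" "g (f x) = x"
    "\<And>m. m \<in> M \<inter> N \<Longrightarrow> g m \<in> V \<and> f (g m) = m"
proof -
  obtain T N g where g: "x \<in> T" "open N" "smooth_on N g" "f ` T \<subseteq> N"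
    "\<forall>y\<in>T. g (f y) = y" "\<forall>m\<in>M \<inter> N. g m \<in> T \<and> f (g m) = m"
    using assms(1,2) unfolding smooth_local_parametrization_def by meson
  have "open (N \<inter> g -` V)"
    using continuous_open_preimage[OF smooth_on_imp_continuous_on[OF g(3)] g(2) assms(3)] .
  moreover have "smooth_on (N \<inter> g -` V) g"
    by (rule smooth_on_subset_dom[OF g(3)]) auto
  ultimately show thesis
    using that[of "N \<inter> g -` V" g] g assms(4) by auto
qed

text \<open>A local inverse with values in \<open>V\<close> shows that the neighbourhood
  \<open>M \<inter> N\<close> of \<open>f x\<close> lies in the image of \<open>V\<close>.\<close>

lemma smooth_local_parametrization_open_image:
  assumes f: "smooth_local_parametrization S f M" and V: "open V" "V \<subseteq> S"
  shows "openin (top_of_set M) (f ` V)"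
proof (subst openin_subopen, clarify)
  fix x assume x: "x \<in> V"
  from x V(2) have xS: "x \<in> S" by blast
  obtain N g where g: "open N" "f x \<in> N" "smooth_on N g" "g (f x) = x"
    "\<And>m. m \<in> M \<inter> N \<Longrightarrow> g m \<in> V \<and> f (g m) = m"
    by (rule smooth_local_parametrizationE[OF f xS V(1) x]) (rule that)
  have "m \<in> f ` V" if "m \<in> M \<inter> N" for m
    using g(5)[OF that] by (metis image_eqI)
  then have "M \<inter> N \<subseteq> f ` V" by blast
  moreover have "f x \<in> M"
    using f x V(2) by (auto simp: smooth_local_parametrization_def)
  ultimately show "\<exists>T. openin (top_of_set M) T \<and> f x \<in> T \<and> T \<subseteq> f ` V"
    using g(1,2) by (intro exI[of _ "M \<inter> N"]) (auto intro: openin_open_Int)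
qed

text \<open>By injectivity on \<open>V\<close>, the ambient local inverses agree with
  \<open>inv_into V f\<close> on its domain and thus extend it smoothly; the inverse of this chart
  is \<open>f\<close> itself.\<close>

lemma smooth_local_parametrization_chart:
  assumes f: "smooth_local_parametrization S f M" and V: "open V" "V \<subseteq> S" "inj_on f V"
  shows "(f ` V, inv_into V f) \<in> submanifold_atlas M"
proof -
  have image: "inv_into V f ` f ` V = V"
    using V(3) by (simp add: inv_into_image_cancel)
  have "smooth_on_subset (f ` V) (inv_into V f)"
    unfolding smooth_on_subset_def
  proof clarify
    fix x assume x: "x \<in> V"
    from x V(2) have xS: "x \<in> S" by blast
    obtain N g where g: "open N" "f x \<in> N" "smooth_on N g" "g (f x) = x"
      "\<And>m. m \<in> M \<inter> N \<Longrightarrow> g m \<in> V \<and> f (g m) = m"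
      by (rule smooth_local_parametrizationE[OF f xS V(1) x]) (rule that)
    have "g m = inv_into V f m" if "m \<in> f ` V \<inter> N" for m
    proof -
      have "m \<in> M"
        using that f V(2) by (auto simp: smooth_local_parametrization_def)
      then show ?thesis
        using g(5)[of m] that inv_into_f_f[OF V(3), of "g m"] by simp
    qed
    then show "\<exists>N h. open N \<and> f x \<in> N \<and> smooth_on N h \<and> (\<forall>m\<in>f ` V \<inter> N. h m = inv_into V f m)"
      using g(1-3) by blast
  qed
  moreover have "smooth_on V (inv_into (f ` V) (inv_into V f))"
  proof -
    have "smooth_on V f"
      using f V(2) smooth_on_subset_dom by (auto simp: smooth_local_parametrization_def)
    moreover have "f x = inv_into (f ` V) (inv_into V f) x" if "x \<in> V" for x
      using that V(3) inv_into_f_f[OF inj_on_inv_into[of "f ` V" f V], of "f x"] by auto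
    ultimately show ?thesis
      using smooth_on_cong[OF V(1), of f "inv_into (f ` V) (inv_into V f)"] by blast
  qed
  ultimately show ?thesis
    using smooth_local_parametrization_open_image[OF f V(1,2)] V(1)
    by (auto simp: submanifold_atlas_def image inj_on_inv_into)
qed

text \<open>The classes are the fibres of \<open>f\<close>, so \<open>F\<close> is a bijection onto
  \<open>M\<close>, and a homeomorphism because \<open>f\<close> is continuous and open. A quotient
  chart over \<open>V\<close> is the pullback of the submanifold chart
  \<open>inv_into V f\<close>.\<close>

lemma diffeomorphism_quotient:
  fixes f :: "'a::euclidean_space \<Rightarrow> 'b::euclidean_space"
  assumes f: "smooth_local_parametrization S f M"
    and class_eq_iff: "\<And>x y. x \<in> S \<Longrightarrow> y \<in> S \<Longrightarrow> r `` {x} = r `` {y} \<longleftrightarrow> f x = f y"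
    and F: "\<And>x. x \<in> S \<Longrightarrow> F (r `` {x}) = f x"
  shows "diffeomorphism (quotient_topology S r) (quotient_atlas S r)
    (top_of_set M) (submanifold_atlas M :: ('b, 'a) chart set) F"
proof -
  have S: "open S" "continuous_on S f" "f ` S = M"
    using f smooth_on_imp_continuous_on by (auto simp: smooth_local_parametrization_def)
  \<comment> \<open>Hence the same sets \<open>V\<close> give charts of the quotient and of
    \<open>M\<close>.\<close>
  have inj_iff: "inj_on (\<lambda>x. r `` {x}) V \<longleftrightarrow> inj_on f V" if "V \<subseteq> S" for V
    unfolding inj_on_def using class_eq_iff that by blast
  have local_inj: "\<exists>V. open V \<and> x \<in> V \<and> V \<subseteq> S \<and> inj_on f V" if "x \<in> S" for x
  proof -
    have "\<exists>T g. open T \<and> x \<in> T \<and> T \<subseteq> S \<and> (\<forall>y\<in>T. g (f y) = y)"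
      using f that unfolding smooth_local_parametrization_def by blast
    then show ?thesis using inj_on_inverseI by metis
  qed
  have F_image: "F ` (\<lambda>x. r `` {x}) ` V = f ` V" if "V \<subseteq> S" for V
    using F that by (force simp: image_image)
  have classes: "S // r = (\<lambda>x. r `` {x}) ` S"
    by (auto simp: quotient_def)

  have homeo: "homeomorphic_map (quotient_topology S r) (top_of_set M) F"
  proof (rule bijective_open_imp_homeomorphic_map)
    have "continuous_map (top_of_set S) (top_of_set M) (F \<circ> (\<lambda>x. r `` {x}))"
      using S continuous_on_eq[OF S(2), of "F \<circ> (\<lambda>x. r `` {x})"] F by auto
    then show "continuous_map (quotient_topology S r) (top_of_set M) F"
      by (rule continuous_compose_quotient_map[OF quotient_map_class])
    show "open_map (quotient_topology S r) (top_of_set M) F"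
      unfolding open_map_def
    proof (intro allI impI)
      fix W assume "openin (quotient_topology S r) W"
      then have W: "W \<subseteq> S // r" "open {x \<in> S. r `` {x} \<in> W}"
        using S(1) by (auto simp: openin_quotient_topology openin_open_eq)
      \<comment> \<open>\<open>W\<close> is the image of its open preimage in \<open>S\<close>, so
        its image under \<open>F\<close> is the image of an open set under \<open>f\<close>.\<close>
      then have "W = (\<lambda>x. r `` {x}) ` {x \<in> S. r `` {x} \<in> W}"
        by (auto simp: classes)
      then have "F ` W = f ` {x \<in> S. r `` {x} \<in> W}"
        using F_image[of "{x \<in> S. r `` {x} \<in> W}"] by auto
      then show "openin (top_of_set M) (F ` W)"
        using smooth_local_parametrization_open_image[OF f W(2)] by auto
    qed
    show "F ` topspace (quotient_topology S r) = topspace (top_of_set M)"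
      using F_image[of S] S(3) by (simp add: classes)
    show "inj_on F (topspace (quotient_topology S r))"
      using class_eq_iff F by (auto simp: classes inj_on_def)
  qed
  have manifold: "smooth_manifold (top_of_set M) (submanifold_atlas M :: ('b, 'a) chart set)"
  proof (rule smooth_manifold_submanifold_atlas, rule antisym)
    show "(\<Union>c\<in>(submanifold_atlas M :: ('b, 'a) chart set). fst c) \<subseteq> M"
      using openin_imp_subset by (fastforce simp: submanifold_atlas_def)
    have "f x \<in> (\<Union>c\<in>(submanifold_atlas M :: ('b, 'a) chart set). fst c)" if x: "x \<in> S" for x
    proof -
      obtain V where V: "open V" "x \<in> V" "V \<subseteq> S" "inj_on f V"
        using local_inj[OF x] by blast
      then show ?thesis
        using smooth_local_parametrization_chart[OF f V(1,3,4)] by force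
    qed
    then show "M \<subseteq> (\<Union>c\<in>(submanifold_atlas M :: ('b, 'a) chart set). fst c)"
      using S(3) by blast
  qed
  have cover: "(\<Union>c\<in>quotient_atlas S r. fst c) = topspace (quotient_topology S r)"
  proof (rule antisym)
    show "(\<Union>c\<in>quotient_atlas S r. fst c) \<subseteq> topspace (quotient_topology S r)"
      by (auto simp: quotient_atlas_def intro!: quotientI)
    have "r `` {x} \<in> (\<Union>c\<in>quotient_atlas S r. fst c)" if x: "x \<in> S" for x
    proof -
      obtain V where V: "open V" "x \<in> V" "V \<subseteq> S" "inj_on f V"
        using local_inj[OF x] by blast
      have "((\<lambda>x. r `` {x}) ` V, inv_into V (\<lambda>x. r `` {x})) \<in> quotient_atlas S r"
        using V inj_iff[OF V(3)] unfolding quotient_atlas_def by blast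
      then show ?thesis using V(2) by force
    qed
    then show "topspace (quotient_topology S r) \<subseteq> (\<Union>c\<in>quotient_atlas S r. fst c)"
      unfolding topspace_quotient_topology classes by blast
  qed
  have pullback: "\<exists>\<xi>. (F ` U, \<xi>) \<in> (submanifold_atlas M :: ('b, 'a) chart set) \<and> (\<forall>c\<in>U. \<phi> c = \<xi> (F c))"
    if "(U, \<phi>) \<in> quotient_atlas S r" for U \<phi>
  proof -
    from that obtain V where V: "open V" "V \<subseteq> S" "inj_on (\<lambda>x. r `` {x}) V"
      and U: "U = (\<lambda>x. r `` {x}) ` V" "\<phi> = inv_into V (\<lambda>x. r `` {x})"
      by (auto simp: quotient_atlas_def)
    have inj: "inj_on f V" using V inj_iff by blast
    have "\<phi> c = inv_into V f (F c)" if c: "c \<in> U" for c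
    proof -
      obtain x where x: "x \<in> V" "c = r `` {x}" using c U(1) by blast
      then have "\<phi> c = x" "F c = f x"
        using V U(2) F inv_into_f_f[OF V(3) x(1)] by auto
      then show ?thesis using inj x(1) by simp
    qed
    moreover have "F ` U = f ` V"
      using F_image[OF V(2)] U(1) by simp
    ultimately show ?thesis
      using smooth_local_parametrization_chart[OF f V(1,2) inj] by (intro exI[of _ "inv_into V f"]) simp
  qed
  show ?thesis
    by (rule diffeomorphism_pullback[OF homeo manifold cover pullback])
qed

section \<open>The parametrization of the surface\<close>

text \<open>The third coordinate gives \<open>q\<close>. If \<open>q \<noteq> 0\<close>, cancelling
  \<open>q ^ k\<close> leaves angles with equal sine and cosine, so they differ by
  \<open>2 * pi * n\<close>, that is, \<open>p' = p + n * q\<close>; if \<open>q = 0\<close>, the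
  whole line is one class.\<close>

lemma phi_eq_iff:
  assumes "k > 0"
  shows "phi k x = phi k y \<longleftrightarrow> (x, y) \<in> closed_rel"
proof
  assume "(x, y) \<in> closed_rel"
  then show "phi k x = phi k y"
    using phi_respects by (auto simp: congruent_def)
next
  obtain p q p' q' where xy: "x = (p, q)" "y = (p', q')"
    by (cases x, cases y) blast
  assume eq: "phi k x = phi k y"
  then have q: "q' = q"
    by (auto simp: xy phi_def split: if_splits)
  show "(x, y) \<in> closed_rel"
  proof (cases "q = 0")
    case False
    then have "sin (2 * pi * p' / q) = sin (2 * pi * p / q) \<and> cos (2 * pi * p' / q) = cos (2 * pi * p / q)"
      using eq by (simp add: xy q phi_def)
    then obtain n :: int where "2 * pi * p' / q = 2 * pi * p / q + 2 * pi * n"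
      unfolding sin_cos_eq_iff by blast
    then have "2 * pi * p' = 2 * pi * (p + n * q)"
      using False by (simp add: field_simps)
    then have "p' = p + n * q" by simp
    then show ?thesis by (auto simp: xy q closed_rel_iff)
  qed (simp add: xy q closed_rel_iff)
qed

lemma closed_rel_class_eq_iff: "closed_rel `` {x} = closed_rel `` {y} \<longleftrightarrow> (x, y) \<in> closed_rel"
  using eq_equiv_class_iff[OF equiv_closed_rel, of x y] by simp

text \<open>At \<open>z = 0\<close> the equation reads \<open>x\<^sup>2 + y\<^sup>2 = 0\<close>,
  because the exponent is positive. Removing the origin therefore amounts to requiring
  \<open>z \<noteq> 0\<close>.\<close>

lemma A_surface_zero_iff:
  assumes "k > 0" "(x, y, z) \<in> A_surface (2 * k)"
  shows "(x, y, z) = 0 \<longleftrightarrow> z = 0"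
proof -
  have "x = 0 \<and> y = 0" if "z = 0"
    using assms that by (simp add: A_surface_def zero_power)
  then show ?thesis by (auto simp: zero_prod_def)
qed

lemma phi_image_R_Rstar:
  assumes "k > 0"
  shows "phi k ` R_Rstar = A_surface (2 * k) - {0}"
proof
  show "phi k ` R_Rstar \<subseteq> A_surface (2 * k) - {0}"
  proof (rule image_subsetI)
    fix x :: "real \<times> real"
    assume "x \<in> R_Rstar"
    then have "phi k x \<noteq> 0" by (auto simp: R_Rstar_def phi_def zero_prod_def)
    then show "phi k x \<in> A_surface (2 * k) - {0}"
      using phi_in_A_surface[OF assms] by blast
  qed
  show "A_surface (2 * k) - {0} \<subseteq> phi k ` R_Rstar"
  proof (rule subsetI)
    fix m
    assume A: "m \<in> A_surface (2 * k) - {0}"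
    obtain x y z where xyz: "m = (x, y, z)" by (cases m)
    with A have m: "(x, y, z) \<in> A_surface (2 * k)" "(x, y, z) \<noteq> 0" by simp_all
    then have z: "z \<noteq> 0" using A_surface_zero_iff[OF assms] by blast
    have "x\<^sup>2 + y\<^sup>2 = (z ^ k)\<^sup>2"
      using m(1) by (simp add: A_surface_def power_mult[symmetric] mult.commute)
    \<comment> \<open>Scaling by \<open>z ^ k\<close> moves the horizontal section to the unit
      circle, whose points have an angle \<open>t\<close>.\<close>
    then have "(x / z ^ k)\<^sup>2 + (y / z ^ k)\<^sup>2 = 1"
      using z by (simp add: power_divide add_divide_distrib[symmetric])
    then obtain t where t: "x / z ^ k = cos t" "y / z ^ k = sin t"
      using sincos_total_2pi by metis
    \<comment> \<open>The witness solves \<open>2 * pi * p / z = t\<close> for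
      \<open>p\<close>.\<close>
    have "phi k (z * t / (2 * pi), z) = (x, y, z)"
      using z t by (simp add: phi_def field_simps)
    moreover have "(z * t / (2 * pi), z) \<in> R_Rstar"
      using z by (simp add: R_Rstar_def)
    ultimately show "m \<in> phi k ` R_Rstar"
      unfolding xyz by (metis image_eqI)
  qed
qed

lemma phi_image:
  assumes "k > 0"
  shows "range (phi k) = A_surface (2 * k)"
proof
  show "range (phi k) \<subseteq> A_surface (2 * k)"
    using phi_in_A_surface[OF assms] by blast
  have "phi k (0, 0) = 0" by (simp add: phi_def zero_prod_def)
  then have "0 \<in> range (phi k)" by (metis rangeI)
  then show "A_surface (2 * k) \<subseteq> range (phi k)"
    using phi_image_R_Rstar[OF assms] by blast
qed

lemma bij_betw_phi_bar:
  assumes "k > 0"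
  shows "bij_betw (phi_bar k) (UNIV // closed_rel) (A_surface (2 * k))"
proof -
  have classes: "UNIV // closed_rel = range (\<lambda>x. closed_rel `` {x})"
    by (auto simp: quotient_def)
  have "phi_bar k ` (UNIV // closed_rel) = range (phi k)"
    unfolding classes image_image phi_bar_class ..
  moreover have "inj_on (phi_bar k) (UNIV // closed_rel)"
    by (auto simp: classes inj_on_def phi_bar_class phi_eq_iff[OF assms] closed_rel_class_eq_iff)
  ultimately show ?thesis
    using phi_image[OF assms] by (simp add: bij_betw_def)
qed

section \<open>Smoothness and local inverses of the parametrization\<close>

lemma open_R_Rstar: "open R_Rstar"
proof -
  have eq: "R_Rstar = {x. snd x \<noteq> 0}" by (auto simp: R_Rstar_def)
  show ?thesis
    unfolding eq by (intro open_Collect_neq continuous_intros)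
qed

lemma smooth_on_phi: "smooth_on R_Rstar (phi k)"
proof -
  have proj: "smooth_on R_Rstar (fst :: real \<times> real \<Rightarrow> real)" "smooth_on R_Rstar (snd :: real \<times> real \<Rightarrow> real)"
    by (auto intro: smooth_on_bounded_linear bounded_linear_fst bounded_linear_snd open_R_Rstar)
  \<comment> \<open>The angle, with division written as multiplication by an inverse to match the
    closure rules.\<close>
  define a where "a x = 2 * pi * fst x * inverse (snd x)" for x :: "real \<times> real"
  have "smooth_on R_Rstar a"
    unfolding a_def by (rule smooth_on_mult smooth_on_const proj smooth_on_inverse open_R_Rstar)+
      (auto simp: R_Rstar_def)
  then have "smooth_on R_Rstar (\<lambda>x. (snd x ^ k * cos (a x), snd x ^ k * sin (a x), snd x))"
    by (intro smooth_on_Pair smooth_on_mult smooth_on_cos smooth_on_sin proj open_R_Rstar smooth_on_power)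
  moreover have "(snd x ^ k * cos (a x), snd x ^ k * sin (a x), snd x) = phi k x" if "x \<in> R_Rstar" for x
    using that by (auto simp: phi_def R_Rstar_def a_def divide_inverse)
  ultimately show ?thesis
    using smooth_on_cong[OF open_R_Rstar,
        of "\<lambda>x. (snd x ^ k * cos (a x), snd x ^ k * sin (a x), snd x)" "phi k"] by blast
qed

text \<open>For \<open>t = 2 * pi * p / q\<close>, rotating the first two coordinates of \<open>phi k (p, q)\<close> by \<open>- \<theta>\<close>
  gives \<open>(u, v) = q ^ k * (cos (t - \<theta>), sin (t - \<theta>))\<close>. The quotient \<open>v / u\<close> determines
  \<open>t - \<theta>\<close> up to a multiple of \<open>\<pi>\<close>; requiring \<open>u * q ^ k > 0\<close> removes the ambiguity,
  whatever the sign of \<open>q ^ k\<close>.\<close>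

definition rot :: "real \<Rightarrow> real \<times> real \<times> real \<Rightarrow> real \<times> real" where
  "rot \<theta> = (\<lambda>(x, y, z). (x * cos \<theta> + y * sin \<theta>, y * cos \<theta> - x * sin \<theta>))"

text \<open>Solves \<open>2 * pi * p / q = \<theta> + arctan (v / u)\<close> for \<open>p\<close>,
  with \<open>q\<close> the third coordinate. The exponent \<open>k\<close> does not enter since
  \<open>q ^ k\<close> cancels in \<open>v / u\<close>.\<close>

definition phi_local_inverse :: "real \<Rightarrow> real \<times> real \<times> real \<Rightarrow> real \<times> real" where
  "phi_local_inverse \<theta> m =
     (snd (snd m) * (\<theta> + arctan (snd (rot \<theta> m) / fst (rot \<theta> m))) / (2 * pi), snd (snd m))"

definition inverse_domain :: "nat \<Rightarrow> real \<Rightarrow> (real \<times> real \<times> real) set" where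
  "inverse_domain k \<theta> = {m. fst (rot \<theta> m) * snd (snd m) ^ k > 0}"

lemma smooth_on_rot:
  assumes "open N"
  shows "smooth_on N (\<lambda>m. fst (rot \<theta> m))" "smooth_on N (\<lambda>m. snd (rot \<theta> m))"
proof -
  have proj: "smooth_on N (fst :: real \<times> real \<times> real \<Rightarrow> real)"
    "smooth_on N (\<lambda>m::real \<times> real \<times> real. fst (snd m))"
    by (auto intro!: smooth_on_bounded_linear bounded_linear_fst bounded_linear_fst_comp
        bounded_linear_snd assms)
  show "smooth_on N (\<lambda>m. fst (rot \<theta> m))" "smooth_on N (\<lambda>m. snd (rot \<theta> m))"
    unfolding rot_def case_prod_unfold fst_conv snd_conv
    by (intro smooth_on_add smooth_on_diff smooth_on_mult smooth_on_const proj assms)+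
qed

lemma open_inverse_domain: "open (inverse_domain k \<theta>)"
proof -
  have "continuous_on UNIV (\<lambda>m. fst (rot \<theta> m) * snd (snd m) ^ k)"
    by (intro continuous_on_mult smooth_on_imp_continuous_on[OF smooth_on_rot(1)] continuous_intros open_UNIV)
  then show ?thesis
    unfolding inverse_domain_def by (intro open_Collect_less continuous_on_const)
qed

lemma smooth_on_phi_local_inverse: "smooth_on (inverse_domain k \<theta>) (phi_local_inverse \<theta>)"
proof -
  have z: "smooth_on (inverse_domain k \<theta>) (\<lambda>m. snd (snd m))"
    by (intro smooth_on_bounded_linear bounded_linear_snd_comp bounded_linear_snd open_inverse_domain)
  have "smooth_on (inverse_domain k \<theta>)
    (\<lambda>m. (snd (snd m) * (\<theta> + arctan (snd (rot \<theta> m) * inverse (fst (rot \<theta> m)))) * inverse (2 * pi), snd (snd m)))"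
    by (intro smooth_on_Pair smooth_on_mult smooth_on_add smooth_on_arctan smooth_on_const z smooth_on_rot
        smooth_on_inverse open_inverse_domain) (auto simp: inverse_domain_def)
  then show ?thesis
    by (simp only: phi_local_inverse_def[abs_def] divide_inverse)
qed

text \<open>Within \<open>pi / 2\<close> of \<open>\<theta>\<close> the cosine of
  \<open>t - \<theta>\<close> is positive, so
  \<open>u * q ^ k = cos (t - \<theta>) * (q ^ k)\<^sup>2\<close> is positive too, and
  \<open>arctan\<close> inverts \<open>tan\<close> there.\<close>

lemma phi_local_inverse_phi:
  assumes "q \<noteq> 0" "\<bar>2 * pi * p / q - \<theta>\<bar> < pi / 2"
  shows "phi k (p, q) \<in> inverse_domain k \<theta>" "phi_local_inverse \<theta> (phi k (p, q)) = (p, q)"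
proof -
  define t where "t = 2 * pi * p / q"
  have rot: "rot \<theta> (phi k (p, q)) = (q ^ k * cos (t - \<theta>), q ^ k * sin (t - \<theta>))"
    using assms(1) by (simp add: rot_def phi_def t_def cos_diff sin_diff algebra_simps)
  have t: "- (pi / 2) < t - \<theta>" "t - \<theta> < pi / 2"
    using assms(2) unfolding t_def by linarith+
  have z: "snd (snd (phi k (p, q))) = q" by (simp add: phi_def)
  have "cos (t - \<theta>) > 0" using t by (rule cos_gt_zero_pi)
  moreover have "(q ^ k)\<^sup>2 > 0" using assms(1) by simp
  ultimately have "cos (t - \<theta>) * (q ^ k)\<^sup>2 > 0" by (rule mult_pos_pos)
  then show "phi k (p, q) \<in> inverse_domain k \<theta>"
    by (simp add: inverse_domain_def rot z power2_eq_square ac_simps)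
  have "arctan (q ^ k * sin (t - \<theta>) / (q ^ k * cos (t - \<theta>))) = t - \<theta>"
    using assms(1) arctan_tan[OF t] by (simp add: tan_def)
  then show "phi_local_inverse \<theta> (phi k (p, q)) = (p, q)"
    using assms(1) by (simp add: phi_local_inverse_def rot z) (simp add: t_def)
qed

text \<open>With \<open>\<alpha> = arctan (v / u)\<close>, the equation of the surface determines
  \<open>cos \<alpha> * z ^ k\<close> up to sign, and the condition defining
  \<open>inverse_domain\<close> fixes the sign. Rotating back by \<open>\<theta>\<close> then
  recovers the point.\<close>

lemma phi_phi_local_inverse:
  assumes "k > 0" "m \<in> A_surface (2 * k)" "m \<in> inverse_domain k \<theta>"
  defines "x \<equiv> phi_local_inverse \<theta> m"
  shows "snd x \<noteq> 0" "\<bar>2 * pi * fst x / snd x - \<theta>\<bar> < pi / 2" "phi k x = m"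
proof -
  obtain a b z where m: "m = (a, b, z)" by (cases m)
  obtain u v where uv: "rot \<theta> m = (u, v)" by (cases "rot \<theta> m")
  have pos: "u * z ^ k > 0" using assms(3) by (simp add: inverse_domain_def m uv[unfolded m])
  then have z: "z \<noteq> 0" "u \<noteq> 0" using \<open>k > 0\<close> by (auto simp: zero_power)
  define \<alpha> where "\<alpha> = arctan (v / u)"
  have x: "x = (z * (\<theta> + \<alpha>) / (2 * pi), z)"
    by (simp add: x_def phi_local_inverse_def uv \<alpha>_def) (simp add: m)
  have angle: "2 * pi * fst x / snd x = \<theta> + \<alpha>" using z by (simp add: x)
  show "snd x \<noteq> 0" using z by (simp add: x)
  show "\<bar>2 * pi * fst x / snd x - \<theta>\<bar> < pi / 2"
    unfolding angle using arctan_bounded[of "v / u"] by (auto simp: \<alpha>_def abs_less_iff)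
  have u: "u = a * cos \<theta> + b * sin \<theta>" and v: "v = b * cos \<theta> - a * sin \<theta>"
    using uv by (auto simp: m rot_def)
  \<comment> \<open>Rotation preserves the norm.\<close>
  have "u\<^sup>2 + v\<^sup>2 = (a\<^sup>2 + b\<^sup>2) * ((sin \<theta>)\<^sup>2 + (cos \<theta>)\<^sup>2)"
    unfolding u v by algebra
  also have "\<dots> = (z ^ k)\<^sup>2"
    using assms(2) by (simp add: m A_surface_def power_mult[symmetric] mult.commute)
  finally have norm: "u\<^sup>2 + v\<^sup>2 = (z ^ k)\<^sup>2" .
  have cos: "cos \<alpha> > 0" by (simp add: \<alpha>_def cos_arctan add_pos_nonneg)
  \<comment> \<open>This is \<open>tan \<alpha> = v / u\<close> with denominators cleared.\<close>
  have sin: "sin \<alpha> * u = cos \<alpha> * v"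
    using cos tan_arctan[of "v / u"] z by (simp add: tan_def \<alpha>_def[symmetric] field_simps)
  have "(cos \<alpha> * z ^ k)\<^sup>2 = (cos \<alpha> * u)\<^sup>2 + (cos \<alpha> * v)\<^sup>2"
    unfolding power_mult_distrib norm[symmetric] by (simp add: distrib_left)
  also have "\<dots> = u\<^sup>2 * ((sin \<alpha>)\<^sup>2 + (cos \<alpha>)\<^sup>2)"
    unfolding sin[symmetric] by algebra
  finally have "(cos \<alpha> * z ^ k)\<^sup>2 = u\<^sup>2" by simp
  then have "cos \<alpha> * z ^ k = u \<or> cos \<alpha> * z ^ k = - u"
    by (simp add: power2_eq_iff)
  \<comment> \<open>The opposite sign would make \<open>u * z ^ k\<close> at most zero.\<close>
  moreover have "cos \<alpha> * z ^ k \<noteq> - u"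
  proof
    assume "cos \<alpha> * z ^ k = - u"
    then have "u = - (cos \<alpha> * z ^ k)" by simp
    then have "u * z ^ k = - (cos \<alpha> * (z ^ k)\<^sup>2)" by (simp add: power2_eq_square)
    moreover have "cos \<alpha> * (z ^ k)\<^sup>2 \<ge> 0" using cos by simp
    ultimately show False using pos by simp
  qed
  ultimately have c: "cos \<alpha> * z ^ k = u" by blast
  have s: "sin \<alpha> * z ^ k = v"
  proof -
    have "cos \<alpha> * (sin \<alpha> * z ^ k) = cos \<alpha> * v"
      unfolding sin[symmetric] c[symmetric] by simp
    then show ?thesis using cos by simp
  qed
  \<comment> \<open>The addition formulas undo the rotation.\<close>
  have "z ^ k * cos (\<theta> + \<alpha>) = u * cos \<theta> - v * sin \<theta>"
    unfolding c[symmetric] s[symmetric] by (simp add: cos_add algebra_simps)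
  also have "\<dots> = a * ((sin \<theta>)\<^sup>2 + (cos \<theta>)\<^sup>2)" unfolding u v by algebra
  finally have a: "z ^ k * cos (\<theta> + \<alpha>) = a" by simp
  have "z ^ k * sin (\<theta> + \<alpha>) = u * sin \<theta> + v * cos \<theta>"
    unfolding c[symmetric] s[symmetric] by (simp add: sin_add algebra_simps)
  also have "\<dots> = b * ((sin \<theta>)\<^sup>2 + (cos \<theta>)\<^sup>2)" unfolding u v by algebra
  finally have b: "z ^ k * sin (\<theta> + \<alpha>) = b" by simp
  show "phi k x = m"
    using z a b by (simp add: x phi_def m)
qed

text \<open>Around \<open>x0\<close>, take \<open>\<theta>\<close> to be the angle of
  \<open>x0\<close> itself and \<open>T\<close> the points whose angle is within
  \<open>pi / 2\<close> of it; the local inverse is then two-sided between \<open>T\<close> and the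
  part of the surface in \<open>inverse_domain k \<theta>\<close>.\<close>

lemma smooth_local_parametrization_phi:
  assumes "k > 0"
  shows "smooth_local_parametrization R_Rstar (phi k) (A_surface (2 * k) - {0})"
  unfolding smooth_local_parametrization_def
proof (intro conjI open_R_Rstar smooth_on_phi phi_image_R_Rstar[OF assms] ballI)
  fix x0 assume x0: "x0 \<in> R_Rstar"
  define \<theta> where "\<theta> = 2 * pi * fst x0 / snd x0"
  define T where "T = {x. snd x \<noteq> 0 \<and> \<bar>2 * pi * fst x / snd x - \<theta>\<bar> < pi / 2}"
  have "continuous_on R_Rstar (\<lambda>x. 2 * pi * fst x / snd x)"
    by (intro continuous_intros) (auto simp: R_Rstar_def)
  then have "open (R_Rstar \<inter> (\<lambda>x. 2 * pi * fst x / snd x) -` ball \<theta> (pi / 2))"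
    by (rule continuous_open_preimage[OF _ open_R_Rstar open_ball])
  also have "R_Rstar \<inter> (\<lambda>x. 2 * pi * fst x / snd x) -` ball \<theta> (pi / 2) = T"
    by (auto simp: T_def R_Rstar_def dist_real_def abs_minus_commute)
  finally have "open T" .
  moreover have "x0 \<in> T" "T \<subseteq> R_Rstar"
    using x0 by (auto simp: T_def R_Rstar_def \<theta>_def)
  moreover have "phi k x \<in> inverse_domain k \<theta>" "phi_local_inverse \<theta> (phi k x) = x" if "x \<in> T" for x
    using that phi_local_inverse_phi[of "snd x" "fst x" \<theta> k] by (auto simp: T_def)
  moreover have "phi_local_inverse \<theta> m \<in> T" "phi k (phi_local_inverse \<theta> m) = m"
    if "m \<in> (A_surface (2 * k) - {0}) \<inter> inverse_domain k \<theta>" for m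
    using that phi_phi_local_inverse[OF assms, of m \<theta>] by (auto simp: T_def)
  ultimately show "\<exists>T N g. open T \<and> x0 \<in> T \<and> T \<subseteq> R_Rstar \<and> open N \<and> smooth_on N g \<and> phi k ` T \<subseteq> N \<and>
        (\<forall>y\<in>T. g (phi k y) = y) \<and> (\<forall>m\<in>(A_surface (2 * k) - {0}) \<inter> N. g m \<in> T \<and> phi k (g m) = m)"
    using open_inverse_domain smooth_on_phi_local_inverse
    by (intro exI[of _ T] exI[of _ "inverse_domain k \<theta>"] exI[of _ "phi_local_inverse \<theta>"]) blast
qed

theorem lemma4p5:
  fixes k :: nat
  assumes "k \<ge> 2"
  shows "bij_betw (phi_bar k) (UNIV // closed_rel) (A_surface (2 * k)) \<and>
    diffeomorphism
      (quotient_topology R_Rstar closed_rel) (quotient_atlas R_Rstar closed_rel)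
      (top_of_set (A_surface (2 * k) - {0}))
      (submanifold_atlas (A_surface (2 * k) - {0}) :: (real \<times> real \<times> real, real \<times> real) chart set)
      (phi_bar k)"
proof
  have k: "k > 0" using assms by simp
  show "bij_betw (phi_bar k) (UNIV // closed_rel) (A_surface (2 * k))"
    by (rule bij_betw_phi_bar[OF k])
  show "diffeomorphism
      (quotient_topology R_Rstar closed_rel) (quotient_atlas R_Rstar closed_rel)
      (top_of_set (A_surface (2 * k) - {0}))
      (submanifold_atlas (A_surface (2 * k) - {0}) :: (real \<times> real \<times> real, real \<times> real) chart set)
      (phi_bar k)"
    \<comment> \<open>The fibre condition holds because two points have equal classes under
      \<open>closed_rel\<close> exactly when \<open>phi k\<close> agrees on them.\<close>
    by (rule diffeomorphism_quotient[OF smooth_local_parametrization_phi[OF k]])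
      (simp_all add: closed_rel_class_eq_iff phi_eq_iff[OF k] phi_bar_class)
qed

end
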